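(* Let $s>0$ and $0\le\kappa<1$. In the class of $2\pi$-periodic equations $\Lambda^su=Vu$ with $$\|V^{(m)}\|_{L^\infty(\mathbb T)}\le C_0M^m(m!)^\kappa,$$ the following two improvements of the fractional estimate (F) recalled in the context are impossible. (1) If $b<\left(\frac{1-\kappa}{s}\right)^{1-\kappa}$, then there are no constants $C,K>0$, independent of $M$, such that every normalized solution in this class, say with $\|u\|_{L^\infty(\mathbb T)}=1$, satisfies $$\|u^{(m)}\|_{L^\infty(\mathbb T)}\le C(bM+K)^m\frac{m!}{\big(\log(m+e)\big)^{(1-\kappa)m}},\qquad m=0,1,2,\dots .$$ (2) For every $\varepsilon>0$, the denominator $\big(\log(m+e)\big)^{(1-\kappa)m}$ cannot in general be replaced with $\big(\log(m+e)\big)^{(1-\kappa+\varepsilon)m}$.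
   Context: $\mathbb T=\mathbb R/2\pi\mathbb Z$, and $\Lambda^s$ acts on $\mathbb T$ by $\Lambda^se^{inx}=|n|^se^{inx}$, $n\in\mathbb Z$. $V^{(m)},u^{(m)}$ denote $m$-th derivatives, and the bound on $V^{(m)}$ is for $m=0,1,2,\dots$. The fractional estimate (F) is the following. Let $1\le p\le\infty$, let $V$ on $\mathbb R^n$ satisfy $\|D^\alpha V\|_{L^\infty(\mathbb R^n)}\le A_0M^{|\alpha|}(\alpha!)^\kappa$ for all $\alpha\in\mathbb N^n$, with $A_0,M>0$, and let $u\in L^p(\mathbb R^n)$ be a distributional solution of $\Lambda^su=Vu$ with $\|u\|_{L^p(\mathbb R^n)}=1$, where $\Lambda^s$ is the Fourier multiplier with symbol $|\xi|^s$. Then for every $\theta>1$ there are constants $C_\theta,K_\theta>0$, depending only on $s,n,\kappa,p,\theta$, such that for every $\alpha\in\mathbb N^n$ $$\|D^\alpha u\|_{L^p(\mathbb R^n)}\le C_\theta\Big[\theta M\Big(\tfrac{1-\kappa}{s}\Big)^{1-\kappa}+K_\theta(1+A_0^{1/s})^{n+1}\Big]^{|\alpha|}\frac{|\alpha|!}{\big(\log(|\alpha|+e)\big)^{(1-\kappa)|\alpha|}} .$$ *)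

theory Defs
  imports "HOL-Probability.Essential_Supremum" "HOL-Library.Periodic_Fun"
begin

text \<open>
  Functions on the circle \<open>\<real>/2\<pi>\<int>\<close> are \<open>2\<pi>\<close>-periodic functions on the real line; integrals and
  essential suprema are taken over one period.
\<close>

abbreviation circle_measure :: "real measure" where
  "circle_measure \<equiv> lebesgue_on {0..2*pi}"

definition Linf_norm :: "(real \<Rightarrow> complex) \<Rightarrow> ereal" where
  "Linf_norm f = esssup circle_measure (\<lambda>x. ereal (norm (f x)))"

definition Linf_circle :: "(real \<Rightarrow> complex) set" where
  "Linf_circle = {f. periodic_fun_simple f (2*pi) \<and> f \<in> borel_measurable circle_measure
     \<and> Linf_norm f < \<infinity>}"

definition fourier_coeff :: "(real \<Rightarrow> complex) \<Rightarrow> int \<Rightarrow> complex" where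
  "fourier_coeff f n = (LINT x|circle_measure. f x * exp (- (\<i> * of_int n * of_real x))) / (2 * pi)"

text \<open>
  \<open>\<Lambda>\<^sup>s f = g\<close> in the sense of distributions on the circle, where \<open>\<Lambda>\<^sup>s\<close> multiplies \<open>e\<^sup>i\<^sup>n\<^sup>x\<close> by \<open>|n|\<^sup>s\<close>.
  For \<open>s > 0\<close> the multiplier at \<open>n = 0\<close> is \<open>0 powr s = 0\<close>.
\<close>

definition frac_laplacian :: "real \<Rightarrow> (real \<Rightarrow> complex) \<Rightarrow> (real \<Rightarrow> complex) \<Rightarrow> bool" where
  "frac_laplacian s f g \<longleftrightarrow>
     (\<forall>n::int. fourier_coeff g n = of_real (\<bar>real_of_int n\<bar> powr s) * fourier_coeff f n)"

definition nth_deriv :: "nat \<Rightarrow> (real \<Rightarrow> complex) \<Rightarrow> real \<Rightarrow> complex" where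
  "nth_deriv m = (\<lambda>f x. vector_derivative f (at x)) ^^ m"

definition test_function :: "(real \<Rightarrow> complex) \<Rightarrow> bool" where
  "test_function \<phi> \<longleftrightarrow> periodic_fun_simple \<phi> (2*pi) \<and> (\<forall>k x. nth_deriv k \<phi> differentiable (at x))"

definition weak_deriv :: "nat \<Rightarrow> (real \<Rightarrow> complex) \<Rightarrow> (real \<Rightarrow> complex) \<Rightarrow> bool" where
  "weak_deriv m f g \<longleftrightarrow> (\<forall>\<phi>. test_function \<phi> \<longrightarrow>
     (LINT x|circle_measure. f x * nth_deriv m \<phi> x) =
       (-1) ^ m * (LINT x|circle_measure. g x * \<phi> x))"

text \<open>
  The \<open>L\<^sup>\<infinity>\<close> norm of the \<open>m\<close>-th distributional derivative of \<open>f\<close>. That derivative is unique almost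
  everywhere, so the infimum is over a single value; it is \<open>\<infinity>\<close> if the derivative is not in \<open>L\<^sup>\<infinity>\<close>.
\<close>

definition deriv_Linf_norm :: "nat \<Rightarrow> (real \<Rightarrow> complex) \<Rightarrow> ereal" where
  "deriv_Linf_norm m f = (INF g \<in> {g \<in> Linf_circle. weak_deriv m f g}. Linf_norm g)"

definition potential_class :: "real \<Rightarrow> real \<Rightarrow> real \<Rightarrow> (real \<Rightarrow> complex) set" where
  "potential_class \<kappa> C\<^sub>0 M = {V \<in> Linf_circle.
     \<forall>m. deriv_Linf_norm m V \<le> ereal (C\<^sub>0 * M ^ m * (fact m) powr \<kappa>)}"

definition normalized_solution :: "real \<Rightarrow> (real \<Rightarrow> complex) \<Rightarrow> (real \<Rightarrow> complex) \<Rightarrow> bool" where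
  "normalized_solution s V u \<longleftrightarrow>
     u \<in> Linf_circle \<and> Linf_norm u = 1 \<and> frac_laplacian s u (\<lambda>x. V x * u x)"

end

theory Submission
  imports Defs "HOL-Real_Asymp.Real_Asymp"
begin

text \<open>
  Potentials with a single Fourier mode already defeat both improvements, because their solutions are
  explicit. If \<open>V = v e\<^sup>i\<^sup>L\<^sup>x\<close>, then \<open>\<Lambda>\<^sup>s u = V u\<close> says that \<open>(k L)\<^sup>s\<close> times the coefficient of \<open>u\<close> at
  frequency \<open>k L\<close> is \<open>v\<close> times the coefficient at \<open>(k - 1) L\<close>. Up to normalization this gives
  \<open>u = \<Sum>\<^sub>k (v / L\<^sup>s)\<^sup>k (k!)\<^sup>-\<^sup>s e\<^sup>i\<^sup>k\<^sup>L\<^sup>x\<close>, and the sup norm of the \<open>m\<close>-th derivative is at least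
  \<open>(k L)\<^sup>m (v / L\<^sup>s)\<^sup>k (k!)\<^sup>-\<^sup>s\<close> for every \<open>k\<close>, since a Fourier coefficient never exceeds the sup norm.

  The amplitude \<open>v = C\<^sub>0 e\<^sup>-\<^sup>\<kappa>\<^sup>t\<close> is admissible for frequencies \<open>L \<le> M t\<^sup>\<kappa>\<close>, because
  \<open>t\<^sup>m \<le> m! e\<^sup>t\<close>; a large \<open>t\<close> buys long steps \<open>L\<close> at the price of a small amplitude. Reaching
  frequency \<open>k L\<close> in \<open>k\<close> steps costs about \<open>exp (- k (\<kappa> t + s ln k))\<close>, and the best compromise is
  \<open>t = s ln k / (1 - \<kappa>)\<close>, for which the exponent is just \<open>- k t\<close>.
  With \<open>m \<approx> k t\<close> we have \<open>ln m \<approx> ln k + ln t\<close>, and by Stirling's formula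
  \<open>(k M t\<^sup>\<kappa>)\<^sup>m exp (- k t)\<close> is, up to a factor \<open>exp (o(m))\<close>, equal to
  \<open>M\<^sup>m m! t powr (- (1 - \<kappa>) m)\<close>. Since \<open>t \<approx> s ln m / (1 - \<kappa>)\<close>, this is the growth rate
  \<open>(M \<beta>)\<^sup>m m! (ln m) powr (- (1 - \<kappa>) m)\<close> of the fractional estimate, where
  \<open>\<beta> = ((1 - \<kappa>) / s) powr (1 - \<kappa>)\<close>. So neither the constant nor the power of the logarithm can be
  improved.

  The potential depends on \<open>m\<close>. This is harmless, because the constants of the refuted estimates are
  uniform over the class of potentials, and the normalizing factor of \<open>u\<close> is bounded uniformly in \<open>t\<close>
  and \<open>L\<close>. Rounding \<open>M t\<^sup>\<kappa>\<close> down to an integer costs at most replacing \<open>M\<close> by \<open>M - 1\<close>. For the constant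
  this loss is made up by taking \<open>M\<close> large; for the power of the logarithm any \<open>M > 1\<close> does, because
  \<open>(ln m) powr (\<epsilon> m)\<close> outgrows every \<open>q\<^sup>m\<close>.

  The construction is \<open>exists_solution_with_large_derivatives\<close>, the asymptotic comparison is
  \<open>eventually_mode_beats_bound\<close>, and \<open>derivative_bound_violated\<close> combines them.
\<close>

section \<open>Characters and Fourier coefficients on the circle\<close>

definition circle_char :: "int \<Rightarrow> real \<Rightarrow> complex" where
  "circle_char n x = exp (\<i> * of_int n * of_real x)"

lemma norm_circle_char [simp]: "norm (circle_char n x) = 1"
  by (simp add: circle_char_def)

lemma circle_char_add: "circle_char (m + n) x = circle_char m x * circle_char n x"
  by (simp add: circle_char_def ring_distribs exp_add)

lemma continuous_circle_char: "continuous_on S (circle_char n)"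
  unfolding circle_char_def by (intro continuous_intros)

lemma circle_char_2pi [simp]: "circle_char n (x + 2 * pi) = circle_char n x"
proof -
  have "\<i> * of_int n * of_real (x + 2 * pi) = \<i> * of_int n * of_real x + of_int (2 * n) * pi * \<i>"
    by (simp add: algebra_simps)
  then show ?thesis
    using exp_integer_2pi[of "of_int n"]
    by (simp add: circle_char_def exp_add mult_ac)
qed

lemma circle_char_2pi_eq [simp]: "circle_char n (2 * pi) = circle_char n 0"
  using circle_char_2pi[of n 0] by simp

lemma circle_char_0 [simp]: "circle_char 0 = (\<lambda>x. 1)" "circle_char n 0 = 1"
  by (auto simp: circle_char_def)

lemma has_vector_derivative_circle_char:
  "(circle_char n has_vector_derivative (\<i> * of_int n * circle_char n x)) (at x within S)"
  unfolding circle_char_def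
  by (rule has_vector_derivative_real_field) (auto intro!: derivative_eq_intros)

lemma integrable_circle_continuous:
  fixes f :: "real \<Rightarrow> complex"
  assumes "continuous_on UNIV f"
  shows "integrable circle_measure f"
  using continuous_imp_integrable_real[OF continuous_on_subset[OF assms]] by blast

lemma integral_derivative_periodic:
  fixes f f' :: "real \<Rightarrow> complex"
  assumes "\<And>x. (f has_vector_derivative f' x) (at x)" "continuous_on UNIV f'"
    and "f (2 * pi) = f 0"
  shows "(LINT x|circle_measure. f' x) = 0"
proof -
  have "(f' has_integral (f (2*pi) - f 0)) {0..2*pi}"
    by (rule fundamental_theorem_of_calculus) (auto intro: has_vector_derivative_at_within assms)
  then show ?thesis
    using assms(3) lebesgue_integral_eq_integral[OF integrable_circle_continuous[OF assms(2)]]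
    by (simp add: integral_unique)
qed

lemma integral_circle_char:
  "(LINT x|circle_measure. circle_char n x) = (if n = 0 then 2 * pi else 0)"
proof (cases "n = 0")
  case True
  have "measure circle_measure {0..2*pi} = 2 * pi"
    by (simp add: measure_restrict_space)
  then show ?thesis using True by (simp add: scaleR_conv_of_real)
next
  case False
  have "(LINT x|circle_measure. \<i> * of_int n * circle_char n x) = 0"
    by (rule integral_derivative_periodic[OF has_vector_derivative_circle_char])
       (auto intro!: continuous_intros continuous_circle_char)
  with False show ?thesis by simp
qed

lemma fourier_coeff_alt:
  "fourier_coeff f n = (LINT x|circle_measure. f x * circle_char (-n) x) / (2 * pi)"
  by (simp add: fourier_coeff_def circle_char_def)

lemma emeasure_circle: "emeasure circle_measure (space circle_measure) = ennreal (2 * pi)"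
  by (simp add: space_restrict_space emeasure_restrict_space)

lemma finite_measure_circle: "finite_measure circle_measure"
  by (rule finite_measureI) (simp only: emeasure_circle, simp)

lemma Linf_circleI:
  assumes "\<And>x. f (x + 2*pi) = f x" "f \<in> borel_measurable circle_measure" "\<And>x. norm (f x) \<le> B"
  shows "f \<in> Linf_circle" "Linf_norm f \<le> ereal B"
proof -
  show le: "Linf_norm f \<le> ereal B"
    unfolding Linf_norm_def by (rule esssup_I) (use assms in auto)
  show "f \<in> Linf_circle"
    using le assms by (auto simp: Linf_circle_def intro!: periodic_fun_simple.intro)
qed

lemma borel_measurable_circle_continuous:
  fixes f :: "real \<Rightarrow> complex"
  shows "continuous_on UNIV f \<Longrightarrow> f \<in> borel_measurable circle_measure"
  by (rule continuous_imp_measurable_on_sets_lebesgue) (auto intro: continuous_on_subset)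

text \<open>
  The average of \<open>f\<close> against a function of modulus 1 is at most the essential supremum of \<open>|f|\<close>. This is the
  only tool for bounding norms from below.
\<close>

lemma fourier_coeff_le_Linf_norm:
  assumes "f \<in> Linf_circle"
  shows "ereal (norm (fourier_coeff f n)) \<le> Linf_norm f"
proof -
  interpret finite_measure circle_measure by (rule finite_measure_circle)
  have meas[measurable]: "f \<in> borel_measurable circle_measure" and fin: "Linf_norm f < \<infinity>"
    using assms by (auto simp: Linf_circle_def)
  have [measurable]: "circle_char k \<in> borel_measurable circle_measure" for k
    by (rule borel_measurable_circle_continuous[OF continuous_circle_char])
  have "Linf_norm f \<ge> 0"
  proof -
    have "esssup circle_measure (\<lambda>x. 0::ereal) \<le> Linf_norm f"
      unfolding Linf_norm_def by (rule esssup_mono) auto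
    moreover have "esssup circle_measure (\<lambda>x. 0::ereal) = 0"
      by (rule esssup_const) (simp only: emeasure_circle, simp)
    ultimately show ?thesis by simp
  qed
  with fin obtain B where B: "Linf_norm f = ereal B" "B \<ge> 0"
    by (cases "Linf_norm f") auto
  have AE: "AE x in circle_measure. norm (f x) \<le> B"
    using esssup_AE[where M = circle_measure and f = "\<lambda>x. ereal (norm (f x))"] B by (simp add: Linf_norm_def)
  have int: "integrable circle_measure (\<lambda>x. f x * circle_char (-n) x)"
    by (rule integrable_const_bound[where B=B]) (use AE in \<open>auto simp: norm_mult\<close>)
  have "norm (LINT x|circle_measure. f x * circle_char (-n) x)
          \<le> (LINT x|circle_measure. norm (f x * circle_char (-n) x))"
    by (rule integral_norm_bound)
  also have "\<dots> \<le> (LINT x|circle_measure. B)"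
    by (rule integral_mono_AE) (use AE integrable_norm[OF int] in \<open>auto simp: norm_mult\<close>)
  also have "\<dots> = 2 * pi * B"
    by (simp add: measure_restrict_space)
  finally have "norm (fourier_coeff f n) \<le> B"
    by (simp add: fourier_coeff_alt norm_divide norm_mult field_simps)
  then show ?thesis using B by simp
qed

section \<open>Norms of distributional derivatives\<close>

lemma nth_deriv_0 [simp]: "nth_deriv 0 f = f"
  by (simp add: nth_deriv_def)

lemma nth_deriv_Suc: "nth_deriv (Suc m) f x = vector_derivative (nth_deriv m f) (at x)"
  by (simp add: nth_deriv_def)

lemma nth_deriv_circle_char: "nth_deriv m (circle_char n) x = (\<i> * of_int n) ^ m * circle_char n x"
proof (induction m arbitrary: x)
  case (Suc m)
  have "((\<lambda>x. (\<i> * of_int n) ^ m * circle_char n x) has_vector_derivative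
           (\<i> * of_int n) ^ m * (\<i> * of_int n * circle_char n x)) (at x)"
    by (rule has_vector_derivative_mult_right[OF has_vector_derivative_circle_char])
  moreover have "nth_deriv m (circle_char n) = (\<lambda>x. (\<i> * of_int n) ^ m * circle_char n x)"
    using Suc.IH by blast
  ultimately show ?case
    by (simp add: nth_deriv_Suc vector_derivative_at)
qed auto

lemma test_function_circle_char: "test_function (circle_char n)"
proof -
  have "(\<lambda>x. (\<i> * of_int n) ^ k * circle_char n x) differentiable (at x)" for k x
    using has_vector_derivative_mult_right[OF has_vector_derivative_circle_char]
    by (metis differentiableI_vector)
  moreover have "nth_deriv k (circle_char n) = (\<lambda>x. (\<i> * of_int n) ^ k * circle_char n x)" for k
    using nth_deriv_circle_char by blast
  ultimately show ?thesis
    unfolding test_function_def by (auto intro: periodic_fun_simple.intro)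
qed

text \<open>
  Characters are themselves test functions, so the definition of the distributional derivative,
  tested against \<open>e\<^sup>-\<^sup>i\<^sup>n\<^sup>x\<close>, determines every Fourier coefficient.
\<close>

lemma fourier_coeff_weak_deriv:
  assumes "weak_deriv m f g"
  shows "fourier_coeff g n = (\<i> * of_int n) ^ m * fourier_coeff f n"
proof -
  have "(LINT x|circle_measure. f x * ((- (\<i> * of_int n)) ^ m * circle_char (-n) x))
          = (-1) ^ m * (LINT x|circle_measure. g x * circle_char (-n) x)"
    using assms test_function_circle_char[of "-n"] by (auto simp: weak_deriv_def nth_deriv_circle_char)
  also have "(\<lambda>x. f x * ((- (\<i> * of_int n)) ^ m * circle_char (-n) x))
      = (\<lambda>x. (- (\<i> * of_int n)) ^ m * (f x * circle_char (-n) x))"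
    by (simp add: mult_ac)
  finally have "(- (\<i> * of_int n)) ^ m * (LINT x|circle_measure. f x * circle_char (-n) x)
          = (-1) ^ m * (LINT x|circle_measure. g x * circle_char (-n) x)"
    by simp
  then have "(\<i> * of_int n) ^ m * (LINT x|circle_measure. f x * circle_char (-n) x)
          = (LINT x|circle_measure. g x * circle_char (-n) x)"
    by (simp add: power_minus[of "\<i> * of_int n"] mult.assoc)
  then show ?thesis by (simp add: fourier_coeff_alt)
qed

text \<open>
  All competitors in the infimum have the same Fourier coefficients. If there is no bounded derivative, the
  right-hand side is the infimum of the empty set, namely \<open>\<infinity>\<close>.
\<close>

lemma deriv_Linf_norm_ge_fourier_coeff:
  "ereal (\<bar>of_int n\<bar> ^ m * norm (fourier_coeff f n)) \<le> deriv_Linf_norm m f"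
  unfolding deriv_Linf_norm_def
proof (rule INF_greatest)
  fix g assume "g \<in> {g \<in> Linf_circle. weak_deriv m f g}"
  then show "ereal (\<bar>of_int n\<bar> ^ m * norm (fourier_coeff f n)) \<le> Linf_norm g"
    using fourier_coeff_le_Linf_norm[of g n] fourier_coeff_weak_deriv[of m f g n]
    by (simp add: norm_mult norm_power)
qed

lemma test_function_deriv:
  assumes "test_function \<phi>"
  shows "(nth_deriv k \<phi> has_vector_derivative nth_deriv (Suc k) \<phi> x) (at x)"
  using assms by (simp add: nth_deriv_Suc test_function_def vector_derivative_works)

lemma test_function_continuous:
  assumes "test_function \<phi>"
  shows "continuous_on UNIV (nth_deriv k \<phi>)"
  using test_function_deriv[OF assms] 
  by (auto intro!: continuous_at_imp_continuous_on has_vector_derivative_continuous)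

lemma test_function_periodic:
  assumes "test_function \<phi>"
  shows "nth_deriv k \<phi> (x + 2 * pi) = nth_deriv k \<phi> x"
proof (induction k arbitrary: x)
  case 0
  then show ?case
    using assms by (auto simp: test_function_def periodic_fun_simple.plus_period)
next
  case (Suc k)
  have "((\<lambda>y. nth_deriv k \<phi> (y + 2 * pi)) has_vector_derivative nth_deriv (Suc k) \<phi> (x + 2 * pi)) (at x)"
  proof -
    have "((\<lambda>y. y + 2 * pi) has_vector_derivative 1) (at x)"
      by (auto intro!: derivative_eq_intros)
    from vector_diff_chain_at[OF this test_function_deriv[OF assms, of k "x + 2 * pi"]]
    show ?thesis by (simp add: o_def)
  qed
  then show ?case
    using Suc.IH test_function_deriv[OF assms, of k x] by (simp add: vector_derivative_unique_at)
qed

text \<open>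
  Integration by parts, once for each derivative; the boundary terms cancel by periodicity.
\<close>

lemma weak_deriv_circle_char:
  "weak_deriv m (\<lambda>x. c * circle_char n x) (\<lambda>x. c * (\<i> * of_int n) ^ m * circle_char n x)"
  unfolding weak_deriv_def
proof (intro allI impI)
  fix \<phi> assume \<phi>: "test_function \<phi>"
  have parts: "(LINT x|circle_measure. circle_char n x * nth_deriv (Suc k) \<phi> x) =
        - (\<i> * of_int n) * (LINT x|circle_measure. circle_char n x * nth_deriv k \<phi> x)" for k
  proof -
    have int: "integrable circle_measure (\<lambda>x. circle_char n x * nth_deriv j \<phi> x)" for j
      by (intro integrable_circle_continuous continuous_intros continuous_circle_char
          test_function_continuous \<phi>)
    have "(LINT x|circle_measure. circle_char n x * nth_deriv (Suc k) \<phi> x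
            + (\<i> * of_int n * circle_char n x) * nth_deriv k \<phi> x) = 0"
    proof (rule integral_derivative_periodic)
      show "((\<lambda>x. circle_char n x * nth_deriv k \<phi> x) has_vector_derivative
          circle_char n x * nth_deriv (Suc k) \<phi> x
            + (\<i> * of_int n * circle_char n x) * nth_deriv k \<phi> x) (at x)" for x
        by (intro has_vector_derivative_mult has_vector_derivative_circle_char test_function_deriv \<phi>)
    qed (use test_function_periodic[OF \<phi>, of k 0] in \<open>auto intro!: continuous_intros
          continuous_circle_char test_function_continuous \<phi>\<close>)
    also have "(\<lambda>x. circle_char n x * nth_deriv (Suc k) \<phi> x
            + (\<i> * of_int n * circle_char n x) * nth_deriv k \<phi> x)
       = (\<lambda>x. circle_char n x * nth_deriv (Suc k) \<phi> x
            + (\<i> * of_int n) * (circle_char n x * nth_deriv k \<phi> x))"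
      by (simp add: mult.assoc)
    finally show ?thesis
      using int by (subst (asm) Bochner_Integration.integral_add) (auto simp: add_eq_0_iff)
  qed
  have "(LINT x|circle_measure. circle_char n x * nth_deriv m \<phi> x)
      = (- (\<i> * of_int n)) ^ m * (LINT x|circle_measure. circle_char n x * \<phi> x)"
    by (induction m) (simp_all add: parts)
  then show "(LINT x|circle_measure. c * circle_char n x * nth_deriv m \<phi> x)
      = (-1) ^ m * (LINT x|circle_measure. c * (\<i> * of_int n) ^ m * circle_char n x * \<phi> x)"
    by (simp add: mult.assoc power_minus[of "\<i> * of_int n"])
qed

section \<open>Single-mode potentials\<close>

text \<open>
  A single mode has constant modulus, so the class condition becomes a condition on numbers.
\<close>

lemma single_mode_in_potential_class:
  assumes "v \<ge> 0" and "\<And>m. v * \<bar>of_int n\<bar> ^ m \<le> C * M ^ m * (fact m) powr \<kappa>"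
  shows "(\<lambda>x. of_real v * circle_char n x) \<in> potential_class \<kappa> C M"
proof -
  let ?g = "\<lambda>m x. of_real v * (\<i> * of_int n) ^ m * circle_char n x"
  have Linf: "?g m \<in> Linf_circle" "Linf_norm (?g m) \<le> ereal (v * \<bar>of_int n\<bar> ^ m)" for m
  proof -
    have "?g m \<in> borel_measurable circle_measure"
      by (intro borel_measurable_circle_continuous continuous_intros continuous_circle_char)
    then show "?g m \<in> Linf_circle" "Linf_norm (?g m) \<le> ereal (v * \<bar>of_int n\<bar> ^ m)"
      using Linf_circleI[of "?g m" "v * \<bar>of_int n\<bar> ^ m"] \<open>v \<ge> 0\<close>
      by (simp_all add: norm_mult norm_power)
  qed
  have "deriv_Linf_norm m (\<lambda>x. of_real v * circle_char n x) \<le> ereal (C * M ^ m * (fact m) powr \<kappa>)" for m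
  proof -
    have "deriv_Linf_norm m (\<lambda>x. of_real v * circle_char n x) \<le> Linf_norm (?g m)"
      unfolding deriv_Linf_norm_def by (rule INF_lower) (use Linf weak_deriv_circle_char in auto)
    also have "\<dots> \<le> ereal (v * \<bar>of_int n\<bar> ^ m)" by (rule Linf)
    also have "\<dots> \<le> ereal (C * M ^ m * (fact m) powr \<kappa>)" using assms(2) by simp
    finally show ?thesis .
  qed
  then show ?thesis using Linf(1)[of 0] by (simp add: potential_class_def)
qed

text \<open>
  Divided by the factorial, the left-hand side is one term of the exponential series.
\<close>

lemma power_le_fact_mult_exp:
  fixes t :: real
  assumes "t \<ge> 0"
  shows "t ^ m \<le> fact m * exp t"
proof -
  have "(\<Sum>n\<in>{m}. t ^ n /\<^sub>R fact n) \<le> (\<Sum>n. t ^ n /\<^sub>R fact n)"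
    by (rule sum_le_suminf) (use assms summable_exp_generic[of t] in auto)
  then show ?thesis by (simp add: exp_def field_simps)
qed

text \<open>
  Raising \<open>t\<^sup>m \<le> m! e\<^sup>t\<close> to the power \<open>\<kappa>\<close> gives \<open>e\<^sup>-\<^sup>\<kappa>\<^sup>t (t\<^sup>\<kappa>)\<^sup>m \<le> (m!)\<^sup>\<kappa>\<close>. Parametrizing the frequency by
  \<open>t\<close> instead of \<open>L\<close> avoids the exponent \<open>1/\<kappa>\<close>, and so \<open>\<kappa> = 0\<close> is not a special case.
\<close>

lemma exponentially_damped_mode_in_potential_class:
  assumes "0 \<le> \<kappa>" "C > 0" "M \<ge> 0" "t > 0" "0 \<le> n" "real_of_int n \<le> M * t powr \<kappa>"
  shows "(\<lambda>x. of_real (C * exp (- \<kappa> * t)) * circle_char n x) \<in> potential_class \<kappa> C M"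
proof (rule single_mode_in_potential_class)
  fix m
  have "\<bar>real_of_int n\<bar> ^ m \<le> (M * t powr \<kappa>) ^ m"
    using assms by (intro power_mono) auto
  also have "\<dots> = M ^ m * (t ^ m) powr \<kappa>"
    using \<open>t > 0\<close> by (simp add: power_mult_distrib powr_power powr_realpow[symmetric] powr_powr mult.commute)
  also have "\<dots> \<le> M ^ m * (fact m * exp t) powr \<kappa>"
    using assms power_le_fact_mult_exp[of t m] by (intro mult_left_mono powr_mono2) auto
  also have "\<dots> = M ^ m * ((fact m) powr \<kappa> * exp (\<kappa> * t))"
    by (simp add: powr_mult exp_powr_real mult.commute)
  finally have "C * exp (- \<kappa> * t) * \<bar>real_of_int n\<bar> ^ m
      \<le> C * exp (- \<kappa> * t) * (M ^ m * ((fact m) powr \<kappa> * exp (\<kappa> * t)))"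
    using \<open>C > 0\<close> by (intro mult_left_mono) auto
  also have "\<dots> = C * M ^ m * (fact m) powr \<kappa>"
    by (simp add: exp_minus)
  finally show "C * exp (- \<kappa> * t) * \<bar>real_of_int n\<bar> ^ m \<le> C * M ^ m * (fact m) powr \<kappa>" .
qed (use assms in simp)

section \<open>Fourier series on the multiples of one frequency\<close>

definition ray_series :: "(nat \<Rightarrow> real) \<Rightarrow> int \<Rightarrow> real \<Rightarrow> complex" where
  "ray_series a L x = (\<Sum>k. of_real (a k) * circle_char (int k * L) x)"

context
  fixes a :: "nat \<Rightarrow> real" and L :: int
  assumes a_nonneg: "\<And>k. 0 \<le> a k" and summable_a: "summable a" and L_pos: "L > 0"
begin

lemma norm_ray_series_le: "norm (ray_series a L x) \<le> suminf a"
  unfolding ray_series_def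
  by (rule order_trans[OF summable_norm]) (use a_nonneg summable_a in \<open>simp_all add: norm_mult\<close>)

lemma ray_series_periodic: "ray_series a L (x + 2 * pi) = ray_series a L x"
  by (simp add: ray_series_def)

lemma borel_measurable_ray_series: "ray_series a L \<in> borel_measurable circle_measure"
proof -
  have "circle_char k \<in> borel_measurable circle_measure" for k
    by (rule borel_measurable_circle_continuous[OF continuous_circle_char])
  then show ?thesis
    unfolding ray_series_def by measurable
qed

lemma fourier_coeff_ray_series_sums:
  "(\<lambda>k. if int k * L = n then of_real (a k) else 0) sums fourier_coeff (ray_series a L) n"
proof -
  define f where "f k x = of_real (a k) * circle_char (int k * L - n) x" for k x
  have int: "integrable circle_measure (f k)" for k
    unfolding f_def
    by (intro integrable_circle_continuous continuous_intros continuous_circle_char)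
  have "(\<lambda>k. integral\<^sup>L circle_measure (f k)) sums (LINT x|circle_measure. (\<Sum>k. f k x))"
  proof (rule sums_integral[OF int])
    show "AE x in circle_measure. summable (\<lambda>k. norm (f k x))"
      using a_nonneg summable_a by (simp add: f_def norm_mult)
    show "summable (\<lambda>k. LINT x|circle_measure. norm (f k x))"
      using a_nonneg summable_a
      by (simp add: f_def norm_mult summable_mult measure_restrict_space)
  qed
  moreover have "integral\<^sup>L circle_measure (f k) = (if int k * L = n then 2 * pi * of_real (a k) else 0)" for k
    unfolding f_def by (simp add: integral_circle_char)
  moreover have "(\<Sum>k. f k x) = ray_series a L x * circle_char (-n) x" for x
  proof -
    have "f k x = of_real (a k) * circle_char (int k * L) x * circle_char (-n) x" for k
      using circle_char_add[of "int k * L" "-n" x] by (simp add: f_def mult.assoc)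
    moreover have "summable (\<lambda>k. of_real (a k) * circle_char (int k * L) x)"
      by (rule summable_norm_cancel) (use a_nonneg summable_a in \<open>simp add: norm_mult\<close>)
    ultimately show ?thesis
      by (simp add: ray_series_def suminf_mult2)
  qed
  ultimately have "(\<lambda>k. if int k * L = n then 2 * pi * of_real (a k) else 0) sums
      (LINT x|circle_measure. ray_series a L x * circle_char (-n) x)"
    by simp
  from sums_divide[OF this, of "2 * pi"]
  have "(\<lambda>k. (if int k * L = n then 2 * pi * of_real (a k) else 0) / (2 * pi)) sums
      fourier_coeff (ray_series a L) n"
    by (simp add: fourier_coeff_alt)
  also have "(\<lambda>k. (if int k * L = n then 2 * pi * of_real (a k) else 0) / (2 * pi))
      = (\<lambda>k. if int k * L = n then of_real (a k) else (0::complex))"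
    by auto
  finally show ?thesis .
qed

lemma fourier_coeff_ray_series_mult: "fourier_coeff (ray_series a L) (int k * L) = of_real (a k)"
proof -
  have "(\<lambda>j. if int j * L = int k * L then of_real (a j) else 0)
      = (\<lambda>j. if j = k then of_real (a j) else (0::complex))"
    using L_pos by auto
  then have "(\<lambda>j. if int j * L = int k * L then of_real (a j) else 0) sums (of_real (a k) :: complex)"
    using sums_single[of k "\<lambda>j. of_real (a j) :: complex"] by simp
  from sums_unique2[OF fourier_coeff_ray_series_sums this] show ?thesis .
qed

lemma fourier_coeff_ray_series_eq_0:
  assumes "\<And>k. n \<noteq> int k * L"
  shows "fourier_coeff (ray_series a L) n = 0"
proof -
  have "(\<lambda>k. if int k * L = n then of_real (a k) else 0) = (\<lambda>k. 0::complex)"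
    using assms by (intro ext if_not_P) auto
  then have "(\<lambda>k. if int k * L = n then of_real (a k) else 0) sums (0::complex)"
    by (simp only: sums_zero)
  from sums_unique2[OF fourier_coeff_ray_series_sums this] show ?thesis .
qed

text \<open>
  Multiplication by \<open>v e\<^sup>i\<^sup>L\<^sup>x\<close> shifts the coefficients by \<open>L\<close>, so the equation becomes a recurrence along the ray.
  At frequency 0 both sides vanish: the multiplier is zero there, and the series has no coefficient at \<open>- L\<close>.
\<close>

lemma frac_laplacian_ray_series:
  assumes "s > 0" and rec: "\<And>k. (real_of_int L * real (Suc k)) powr s * a (Suc k) = v * a k"
  shows "frac_laplacian s (ray_series a L) (\<lambda>x. of_real v * circle_char L x * ray_series a L x)"
  unfolding frac_laplacian_def
proof
  fix n :: int
  let ?u = "ray_series a L"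
  have "(LINT x|circle_measure. of_real v * circle_char L x * ?u x * circle_char (-n) x)
      = of_real v * (LINT x|circle_measure. ?u x * circle_char (- (n - L)) x)"
    using circle_char_add[of L "-n"] by (simp add: algebra_simps)
  then have shift: "fourier_coeff (\<lambda>x. of_real v * circle_char L x * ?u x) n = of_real v * fourier_coeff ?u (n - L)"
    by (simp add: fourier_coeff_alt)
  show "fourier_coeff (\<lambda>x. of_real v * circle_char L x * ?u x) n
          = of_real (\<bar>real_of_int n\<bar> powr s) * fourier_coeff ?u n"
  proof (cases "\<exists>k. n = int k * L")
    case True
    then obtain k where k: "n = int k * L" by blast
    show ?thesis
    proof (cases k)
      case 0
      have "- L \<noteq> int j * L" for j
      proof -
        have "0 \<le> int j * L" using L_pos by simp
        then show ?thesis using L_pos by linarith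
      qed
      then show ?thesis
        using 0 k fourier_coeff_ray_series_eq_0[of "-L"] unfolding shift by simp
    next
      case (Suc j)
      have "n - L = int j * L"
        using k Suc by (simp add: algebra_simps)
      moreover have "\<bar>real_of_int n\<bar> = real_of_int L * real (Suc j)"
        using k Suc L_pos by (simp add: abs_mult)
      moreover have "fourier_coeff ?u n = of_real (a (Suc j))"
        using fourier_coeff_ray_series_mult[of k] k Suc by simp
      ultimately show ?thesis
        unfolding shift using fourier_coeff_ray_series_mult[of j]
        by (simp only: rec of_real_mult[symmetric])
    qed
  next
    case False
    have "n - L \<noteq> int k * L" for k
    proof
      assume "n - L = int k * L"
      then have "n = int (Suc k) * L" by (simp add: algebra_simps)
      with False show False by blast
    qed
    with False show ?thesis
      unfolding shift
      using fourier_coeff_ray_series_eq_0[of n] fourier_coeff_ray_series_eq_0[of "n - L"] by simp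
  qed
qed

end

section \<open>Explicit solutions for single-mode potentials\<close>

lemma summable_power_over_fact_powr:
  fixes c s :: real
  assumes "s > 0"
  shows "summable (\<lambda>k. c ^ k / (fact k) powr s)"
proof -
  have "\<forall>\<^sub>F k in sequentially. 2 * \<bar>c\<bar> \<le> (real k + 1) powr s"
    using assms by real_asymp
  then obtain N where N: "\<And>k. k \<ge> N \<Longrightarrow> 2 * \<bar>c\<bar> \<le> (real k + 1) powr s"
    by (auto simp: eventually_sequentially)
  show ?thesis
  proof (rule summable_ratio_test[of "1/2" N])
    fix k assume "k \<ge> N"
    have "norm (c ^ Suc k / (fact (Suc k)) powr s)
        = (\<bar>c\<bar> / (real k + 1) powr s) * norm (c ^ k / (fact k) powr s)"
      by (simp add: powr_mult norm_power abs_mult add.commute)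
    also have "\<dots> \<le> 1 / 2 * norm (c ^ k / (fact k) powr s)"
      using N[OF \<open>k \<ge> N\<close>] by (intro mult_right_mono) (auto simp: field_simps)
    finally show "norm (c ^ Suc k / (fact (Suc k)) powr s) \<le> 1 / 2 * norm (c ^ k / (fact k) powr s)" .
  qed simp
qed

lemma sum_power_over_fact_powr_pos:
  fixes c s :: real
  assumes "s > 0" "c > 0"
  shows "(\<Sum>j. c ^ j / (fact j) powr s) > 0"
  using summable_power_over_fact_powr[OF assms(1)] assms by (intro suminf_pos) auto

text \<open>
  The solution is the series with coefficients \<open>(v / L\<^sup>s)\<^sup>k (k!)\<^sup>-\<^sup>s\<close> divided by its own norm \<open>r\<close>. Its constant
  coefficient 1 shows \<open>r \<ge> 1\<close>, and \<open>r\<close> is at most the sum of the coefficients. Bounding these with \<open>v \<le> C\<close>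
  and \<open>L \<ge> 1\<close> makes the factor on the right independent of \<open>v\<close> and \<open>L\<close>, which both vary in the asymptotic
  argument.
\<close>

lemma exists_single_mode_solution:
  fixes s C v :: real and L :: int
  assumes "s > 0" "0 < v" "v \<le> C" "L > 0"
  shows "\<exists>u. normalized_solution s (\<lambda>x. of_real v * circle_char L x) u \<and>
    (\<forall>k. (v / real_of_int L powr s) ^ k / (fact k) powr s
           \<le> (\<Sum>j. C ^ j / (fact j) powr s) * norm (fourier_coeff u (int k * L)))"
proof -
  define a where "a k = (v / real_of_int L powr s) ^ k / (fact k) powr s" for k :: nat
  define S where "S = (\<Sum>j. C ^ j / (fact j) powr s)"
  have a_pos: "a k > 0" for k using assms by (simp add: a_def)
  have "real_of_int L powr s \<ge> 1" using assms by (simp add: ge_one_powr_ge_zero)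
  then have "v / real_of_int L powr s \<le> v" using assms by (simp add: divide_le_eq)
  then have a_le: "a k \<le> C ^ k / (fact k) powr s" for k
    unfolding a_def using assms by (intro divide_right_mono power_mono) auto
  have summable_C: "summable (\<lambda>k. C ^ k / (fact k) powr s)"
    by (rule summable_power_over_fact_powr[OF assms(1)])
  have summable_a: "summable a"
    by (rule summable_comparison_test[OF _ summable_C]) (use a_le a_pos in \<open>auto simp: less_imp_le\<close>)
  have "suminf a \<le> S"
    unfolding S_def by (rule suminf_le[OF a_le summable_a summable_C])
  note ray = less_imp_le[OF a_pos] summable_a \<open>L > 0\<close>
  have w: "ray_series a L \<in> Linf_circle" "Linf_norm (ray_series a L) \<le> ereal (suminf a)"
    using Linf_circleI[OF ray_series_periodic[OF ray] borel_measurable_ray_series[OF ray]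
        norm_ray_series_le[OF ray]] by auto
  have "ereal 1 \<le> Linf_norm (ray_series a L)"
    using fourier_coeff_le_Linf_norm[OF w(1), of 0] fourier_coeff_ray_series_mult[OF ray, of 0]
    by (simp add: a_def)
  with w obtain r where r: "Linf_norm (ray_series a L) = ereal r" "1 \<le> r" "r \<le> suminf a"
    by (cases "Linf_norm (ray_series a L)") auto
  define a' where "a' k = a k / r" for k
  have ray': "\<And>k. 0 \<le> a' k" "summable a'" "L > 0"
    using ray r summable_divide[OF summable_a, of r] by (simp_all add: a'_def[abs_def])
  have u_eq: "ray_series a' L x = ray_series a L x / of_real r" for x
  proof -
    have "summable (\<lambda>k. of_real (a k) * circle_char (int k * L) x)"
      by (rule summable_norm_cancel) (use ray in \<open>simp add: norm_mult\<close>)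
    from suminf_divide[OF this, of "of_real r"] show ?thesis
      by (simp add: ray_series_def a'_def)
  qed
  show ?thesis
  proof (intro exI conjI allI)
    have "Linf_norm (ray_series a' L)
        = esssup circle_measure (\<lambda>x. ereal (1 / r) * ereal (norm (ray_series a L x)))"
      using r by (simp add: Linf_norm_def u_eq norm_divide)
    also have "\<dots> = ereal (1 / r) * Linf_norm (ray_series a L)"
      unfolding Linf_norm_def by (rule esssup_cmult) (use r in auto)
    finally have "Linf_norm (ray_series a' L) = 1"
      using r by (simp add: one_ereal_def)
    moreover have "ray_series a' L \<in> Linf_circle"
      by (rule Linf_circleI(1)[OF ray_series_periodic[OF ray'] borel_measurable_ray_series[OF ray']
        norm_ray_series_le[OF ray']])
    moreover have "frac_laplacian s (ray_series a' L) (\<lambda>x. of_real v * circle_char L x * ray_series a' L x)"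
    proof (rule frac_laplacian_ray_series[OF ray' \<open>s > 0\<close>])
      fix k
      have "fact (Suc k) powr s = real (Suc k) powr s * fact k powr s"
        by (simp add: powr_mult)
      then show "(real_of_int L * real (Suc k)) powr s * a' (Suc k) = v * a' k"
        using assms r by (simp add: a'_def a_def powr_mult field_simps del: fact_Suc of_nat_Suc)
    qed
    ultimately show "normalized_solution s (\<lambda>x. of_real v * circle_char L x) (ray_series a' L)"
      by (simp add: normalized_solution_def)
    fix k
    have "a k = r * a' k" using r by (simp add: a'_def)
    also have "\<dots> \<le> S * a' k"
      using r \<open>suminf a \<le> S\<close> ray'(1) by (intro mult_right_mono) auto
    also have "a' k = norm (fourier_coeff (ray_series a' L) (int k * L))"
      using fourier_coeff_ray_series_mult[OF ray', of k] ray'(1)[of k] by simp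
    finally show "(v / real_of_int L powr s) ^ k / (fact k) powr s
           \<le> (\<Sum>j. C ^ j / (fact j) powr s) * norm (fourier_coeff (ray_series a' L) (int k * L))"
      by (simp add: a_def S_def)
  qed
qed

text \<open>
  The real number \<open>B\<close> stands for a proposed bound; this keeps the extended reals out of the asymptotic analysis.
\<close>

lemma exists_solution_with_large_derivatives:
  fixes s \<kappa> C\<^sub>0 M t :: real and L :: int
  assumes "s > 0" "0 \<le> \<kappa>" "C\<^sub>0 > 0" "M > 0" "t > 0" "L > 0" "real_of_int L \<le> M * t powr \<kappa>"
  shows "\<exists>V \<in> potential_class \<kappa> C\<^sub>0 M. \<exists>u. normalized_solution s V u \<and>
    (\<forall>k m B. deriv_Linf_norm m u \<le> ereal B \<longrightarrow>
      (real k * real_of_int L) ^ m * ((C\<^sub>0 * exp (- \<kappa> * t) / real_of_int L powr s) ^ k / (fact k) powr s)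
        \<le> (\<Sum>j. C\<^sub>0 ^ j / (fact j) powr s) * B)"
proof -
  let ?v = "C\<^sub>0 * exp (- \<kappa> * t)" and ?S = "\<Sum>j. C\<^sub>0 ^ j / (fact j) powr s"
  have v: "?v > 0" "?v \<le> C\<^sub>0" using assms by (simp_all add: mult_le_cancel_left1)
  obtain u where u: "normalized_solution s (\<lambda>x. of_real ?v * circle_char L x) u"
    "\<And>k. (?v / real_of_int L powr s) ^ k / (fact k) powr s \<le> ?S * norm (fourier_coeff u (int k * L))"
    using exists_single_mode_solution[OF \<open>s > 0\<close> v \<open>L > 0\<close>] by blast
  have V: "(\<lambda>x. of_real ?v * circle_char L x) \<in> potential_class \<kappa> C\<^sub>0 M"
    by (rule exponentially_damped_mode_in_potential_class) (use assms in auto)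
  have "?S \<ge> 0"
    using summable_power_over_fact_powr[OF \<open>s > 0\<close>] assms by (intro suminf_nonneg) auto
  show ?thesis
  proof (intro bexI[OF _ V] exI conjI allI impI, rule u(1))
    fix k m B assume "deriv_Linf_norm m u \<le> ereal B"
    with deriv_Linf_norm_ge_fourier_coeff[of "int k * L" m u]
    have B: "(real k * real_of_int L) ^ m * norm (fourier_coeff u (int k * L)) \<le> B"
      using \<open>L > 0\<close> by (auto simp: abs_mult dest: order_trans)
    have "(real k * real_of_int L) ^ m * ((?v / real_of_int L powr s) ^ k / (fact k) powr s)
        \<le> (real k * real_of_int L) ^ m * (?S * norm (fourier_coeff u (int k * L)))"
      using u(2)[of k] \<open>L > 0\<close> by (intro mult_left_mono) auto
    also have "\<dots> = ?S * ((real k * real_of_int L) ^ m * norm (fourier_coeff u (int k * L)))"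
      by (simp add: mult_ac)
    also have "\<dots> \<le> ?S * B" using B \<open>?S \<ge> 0\<close> by (rule mult_left_mono)
    finally show "(real k * real_of_int L) ^ m * ((?v / real_of_int L powr s) ^ k / (fact k) powr s)
        \<le> ?S * B" .
  qed
qed

section \<open>Asymptotic comparison with the improved bounds\<close>

text \<open>
  The upper half of Stirling's formula up to a factor linear in \<open>m\<close>, which is negligible here. The inductive step
  is \<open>ln (1 + 1/m) \<ge> 1/(m + 1)\<close>.
\<close>

lemma ln_fact_le: "m > 0 \<Longrightarrow> ln (fact m) \<le> 1 + ln (real m) + real m * ln (real m) - real m"
proof (induction m)
  case (Suc m)
  show ?case
  proof (cases "m = 0")
    case False
    then have "m > 0" by simp
    have "ln (real m / (1 + real m)) \<le> real m / (1 + real m) - 1"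
      using \<open>m > 0\<close> by (intro ln_le_minus_one) auto
    also have "\<dots> = - (1 / (1 + real m))" by (simp add: field_simps)
    finally have "1 / (1 + real m) \<le> ln (1 + real m) - ln (real m)"
      using \<open>m > 0\<close> by (simp add: ln_div)
    then have "1 \<le> (1 + real m) * (ln (1 + real m) - ln (real m))"
      by (simp add: field_simps)
    then show ?thesis
      using Suc.IH[OF \<open>m > 0\<close>] ln_mult[of "1 + real m" "fact m"] by (simp add: algebra_simps)
  qed simp
qed simp

text \<open>
  The comparison is made between logarithms. Write \<open>T = t k\<close> and \<open>N = m k\<close>, so that \<open>N \<ge> k T\<close>. The exponential and
  the factorial on the right contribute \<open>- \<kappa> k T - s k ln k = - k T \<ge> - N\<close>, and this \<open>- N\<close> cancels against the one
  from Stirling's formula. What remains is \<open>N \<Delta>\<close>, where \<open>\<Delta>\<close> is the logarithm of the ratio of the two growth rates,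
  and errors of order \<open>k ln T\<close>, which are negligible against \<open>N\<close> because \<open>T\<close> tends to infinity.
\<close>

lemma eventually_mode_beats_bound:
  fixes s \<kappa> C\<^sub>0 M q \<epsilon> S :: real
  assumes "s > 0" "0 \<le> \<kappa>" "\<kappa> < 1" "C\<^sub>0 > 0" "M > 1" "q > 0" "\<epsilon> \<ge> 0" "S > 0"
    and gap: "q < (M - 1) * ((1 - \<kappa>) / s) powr (1 - \<kappa>) \<or> \<epsilon> > 0"
  defines "t \<equiv> \<lambda>k. s / (1 - \<kappa>) * ln (real k)"
  defines "L \<equiv> \<lambda>k. real_of_int \<lfloor>M * t k powr \<kappa>\<rfloor>"
  defines "m \<equiv> \<lambda>k. nat \<lceil>real k * t k\<rceil>"
  shows "\<forall>\<^sub>F k in sequentially. t k \<ge> 1 \<and> L k > 0 \<and>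
     S * (q ^ m k * (fact (m k) / ln (real (m k) + exp 1) powr ((1 - \<kappa> + \<epsilon>) * real (m k))))
      < (real k * L k) ^ m k * ((C\<^sub>0 * exp (- \<kappa> * t k) / L k powr s) ^ k / (fact k) powr s)"
proof -
  define c where "c = s / (1 - \<kappa>)"
  have c: "c > 0" using assms by (simp add: c_def)
  define \<Delta> where "\<Delta> k = ln (M - 1) - ln q + (1 - \<kappa>) * ln ((1 - \<kappa>) / s) + \<epsilon> * ln (ln (real k))" for k :: nat
  have "\<exists>\<delta>>0. \<forall>\<^sub>F k in sequentially. \<delta> \<le> \<Delta> k"
  proof (cases "\<epsilon> = 0")
    case True
    have "ln q < ln ((M - 1) * ((1 - \<kappa>) / s) powr (1 - \<kappa>))"
      using gap True \<open>q > 0\<close> by (subst ln_less_cancel_iff) auto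
    also have "\<dots> = ln (M - 1) + (1 - \<kappa>) * ln ((1 - \<kappa>) / s)"
      using assms by (simp add: ln_mult ln_powr)
    finally show ?thesis
      using True by (intro exI[of _ "\<Delta> 0"]) (simp add: \<Delta>_def)
  next
    case False
    then have "\<epsilon> > 0" using assms by simp
    then have "\<forall>\<^sub>F k in sequentially. 1 \<le> \<Delta> k"
      unfolding \<Delta>_def by real_asymp
    then show ?thesis by (intro exI[of _ 1]) auto
  qed
  then obtain \<delta> where \<delta>: "\<delta> > 0" "\<forall>\<^sub>F k in sequentially. \<delta> \<le> \<Delta> k" by blast
  have main: "\<forall>\<^sub>F k in sequentially. \<delta> * (real k * (c * ln (real k)))
        - real k * ((s * ln M - ln C\<^sub>0) + s * \<kappa> * ln (c * ln (real k)))
        - ln (real k * (c * ln (real k)) + 1) - (ln S + 3) > 0"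
    using \<open>\<delta> > 0\<close> c by real_asymp
  have large: "\<forall>\<^sub>F k in sequentially. c * ln (real k) \<ge> 1" "\<forall>\<^sub>F k in sequentially. ln (real k) \<ge> 1"
    using c by real_asymp+
  show ?thesis
    using main large \<delta>(2) eventually_gt_at_top[of 0]
  proof eventually_elim
    case (elim k)
    define T where "T = t k"
    define K where "K = real k"
    define l where "l = L k"
    define n where "n = m k"
    define N where "N = real n"
    have T: "T = c * ln K" "T \<ge> 1" using elim by (auto simp: T_def K_def t_def c_def)
    have K: "K \<ge> 1" "ln K \<ge> 1" using elim by (auto simp: K_def)
    have "K > 1" using K by (cases "K = 1") auto
    have KT: "K * T \<ge> 1" "K * T \<ge> K" using K T by (auto intro: order_trans[OF K(1)])
    \<comment> \<open>Rounding down loses less than 1, and \<open>1 \<le> T\<^sup>\<kappa>\<close>.\<close>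
    have "T powr \<kappa> \<ge> 1" using T(2) assms(2) by (simp add: ge_one_powr_ge_zero)
    moreover have "l \<ge> M * T powr \<kappa> - 1" "l \<le> M * T powr \<kappa>"
      unfolding l_def L_def T_def by linarith+
    ultimately have l: "l \<ge> (M - 1) * T powr \<kappa>" "l \<le> M * T powr \<kappa>"
      by (auto simp: algebra_simps)
    have "(M - 1) * T powr \<kappa> > 0" using \<open>M > 1\<close> T(2) by simp
    then have "l > 0" using l(1) by simp
    have ln_l: "ln (M - 1) + \<kappa> * ln T \<le> ln l" "ln l \<le> ln M + \<kappa> * ln T"
    proof -
      have "ln ((M - 1) * T powr \<kappa>) \<le> ln l"
        using l \<open>l > 0\<close> \<open>M > 1\<close> T(2) by (subst ln_le_cancel_iff) auto
      moreover have "ln l \<le> ln (M * T powr \<kappa>)"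
        using l \<open>l > 0\<close> \<open>M > 1\<close> T(2) by (subst ln_le_cancel_iff) auto
      ultimately show "ln (M - 1) + \<kappa> * ln T \<le> ln l" "ln l \<le> ln M + \<kappa> * ln T"
        using \<open>M > 1\<close> T(2) by (simp_all add: ln_mult ln_powr)
    qed
    have N: "N \<ge> K * T" "N \<le> K * T + 1"
      using KT by (simp_all add: N_def n_def m_def K_def T_def)
    then have "N > 0" using KT by linarith
    have ln_fact_k: "ln (fact k) \<le> K * ln K"
    proof -
      have "(fact k :: real) \<le> real k ^ k"
        using fact_le_power[of k, where 'a = real] by simp
      then have "ln (fact k) \<le> ln (real k ^ k)"
        using K by (subst ln_le_cancel_iff) (auto simp: K_def)
      then show ?thesis using K by (simp add: K_def ln_realpow)
    qed
    have ln_fact_n: "ln (fact n) \<le> 3 + ln (K * T + 1) + N * (ln K + ln T) - N"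
    proof -
      have "ln (fact n) \<le> 1 + ln N + N * ln N - N"
        using ln_fact_le[of n] \<open>N > 0\<close> by (simp add: N_def)
      moreover have "ln N \<le> ln (K * T + 1)" using N \<open>N > 0\<close> KT by simp
      moreover have "N * ln N \<le> N * (ln K + ln T) + 2"
      proof -
        have "N / (K * T) \<le> (K * T + 1) / (K * T)"
          using N KT by (intro divide_right_mono) auto
        also have "\<dots> = 1 + 1 / (K * T)"
          using KT by (subst add_divide_distrib, subst divide_self) auto
        finally have quot: "N / (K * T) \<le> 1 + 1 / (K * T)" .
        have "ln (N / (K * T)) \<le> N / (K * T) - 1"
          using \<open>N > 0\<close> KT by (intro ln_le_minus_one) auto
        also have "\<dots> \<le> 1 / (K * T)" using quot by simp
        finally have "ln N - (ln K + ln T) \<le> 1 / (K * T)"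
          using \<open>N > 0\<close> K T(2) by (simp add: ln_div ln_mult)
        then have "N * (ln N - (ln K + ln T)) \<le> N * (1 / (K * T))"
          using \<open>N > 0\<close> by (intro mult_left_mono) auto
        also have "\<dots> \<le> 2"
        proof -
          have "1 / (K * T) \<le> 1" using KT by (subst divide_le_eq_1_pos) auto
          with quot show ?thesis by simp
        qed
        finally show ?thesis by (simp add: algebra_simps)
      qed
      ultimately show ?thesis by linarith
    qed
    \<comment> \<open>Here the constant \<open>(1 - \<kappa>) / s\<close> of the estimate appears, as the ratio of \<open>ln k\<close> to \<open>T\<close>.\<close>
    have lnK: "ln (ln K) = ln T + ln ((1 - \<kappa>) / s)"
    proof -
      have "ln K = T * ((1 - \<kappa>) / s)" using assms by (simp add: T(1) c_def)
      then have "ln (ln K) = ln (T * ((1 - \<kappa>) / s))" by (rule arg_cong)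
      also have "\<dots> = ln T + ln ((1 - \<kappa>) / s)"
        using T(2) \<open>s > 0\<close> \<open>\<kappa> < 1\<close> by (subst ln_mult) auto
      finally show ?thesis .
    qed
    have lnln: "(1 - \<kappa> + \<epsilon>) * ln (ln (N + exp 1)) \<ge> (1 - \<kappa>) * (ln T + ln ((1 - \<kappa>) / s)) + \<epsilon> * ln (ln K)"
    proof -
      have "ln K \<le> ln (N + exp 1)"
      proof -
        have "K \<le> N + exp 1" using N KT exp_gt_zero[of "1::real"] by linarith
        then show ?thesis using K \<open>N > 0\<close> by (subst ln_le_cancel_iff) (auto intro: add_pos_pos)
      qed
      then have "ln (ln K) \<le> ln (ln (N + exp 1))" using K \<open>K > 1\<close> by (subst ln_le_cancel_iff) auto
      then have "(1 - \<kappa> + \<epsilon>) * ln (ln K) \<le> (1 - \<kappa> + \<epsilon>) * ln (ln (N + exp 1))"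
        using assms by (intro mult_left_mono) auto
      then show ?thesis by (simp add: lnK algebra_simps)
    qed
    define W where "W = ln (N + exp 1)"
    have "W > 0" using \<open>N > 0\<close> unfolding W_def
      by (intro ln_gt_zero) (use exp_ge_add_one_self[of 1] in linarith)
    \<comment> \<open>This identity makes \<open>\<kappa> T + s ln k\<close> equal to \<open>T\<close>.\<close>
    have sK: "s * ln K = (1 - \<kappa>) * T" using assms by (simp add: T(1) c_def)
    let ?lhs = "S * (q ^ n * (fact n / W powr ((1 - \<kappa> + \<epsilon>) * N)))"
    let ?rhs = "(K * l) ^ n * ((C\<^sub>0 * exp (- \<kappa> * T) / l powr s) ^ k / (fact k) powr s)"
    have ln_lhs: "ln ?lhs = ln S + N * ln q + ln (fact n) - N * ((1 - \<kappa> + \<epsilon>) * ln W)"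
      using assms \<open>W > 0\<close> by (simp add: ln_mult ln_div ln_powr ln_realpow N_def)
    have ln_rhs: "ln ?rhs = N * (ln K + ln l) + K * (ln C\<^sub>0 - \<kappa> * T - s * ln l) - s * ln (fact k)"
      using assms \<open>l > 0\<close> K by (simp add: ln_mult ln_div ln_powr ln_realpow N_def K_def)
    have 1: "N * (ln (M - 1) + \<kappa> * ln T) \<le> N * ln l"
      using ln_l \<open>N > 0\<close> by (intro mult_left_mono) auto
    have 2: "K * (s * ln l) \<le> K * (s * (ln M + \<kappa> * ln T))"
      using ln_l assms K by (intro mult_left_mono) auto
    have 3: "s * ln (fact k) \<le> (1 - \<kappa>) * T * K"
      using mult_left_mono[OF ln_fact_k, of s] assms sK by (simp add: mult_ac)
    have 4: "N * ((1 - \<kappa>) * (ln T + ln ((1 - \<kappa>) / s)) + \<epsilon> * ln (ln K)) \<le> N * ((1 - \<kappa> + \<epsilon>) * ln W)"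
      using lnln \<open>N > 0\<close> unfolding W_def by (intro mult_left_mono) auto
    have 5: "\<delta> * (K * T) \<le> N * \<Delta> k"
      using N(1) elim \<open>\<delta> > 0\<close> \<open>N > 0\<close> by (subst mult.commute, intro mult_mono) auto
    have 6: "\<delta> * (K * T) - K * ((s * ln M - ln C\<^sub>0) + s * \<kappa> * ln T) - ln (K * T + 1) - (ln S + 3) > 0"
      using elim by (simp add: K_def T(1))
    have "N * \<Delta> k = N * ln (M - 1) - N * ln q + N * ((1 - \<kappa>) * ln ((1 - \<kappa>) / s)) + N * (\<epsilon> * ln (ln K))"
      by (simp add: \<Delta>_def K_def algebra_simps)
    then have "ln ?lhs < ln ?rhs"
      unfolding ln_lhs ln_rhs using 1 2 3 4 5 6 ln_fact_n N(1)
      by (simp add: algebra_simps)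
    moreover have "?lhs > 0" "?rhs > 0" using assms \<open>W > 0\<close> \<open>l > 0\<close> K by auto
    ultimately have "?lhs < ?rhs" by (subst (asm) ln_less_cancel_iff)
    then show ?case
      using T(2) \<open>l > 0\<close> unfolding T_def K_def l_def n_def N_def W_def by blast
  qed
qed

text \<open>
  The case \<open>q \<le> 0\<close>, which arises from negative \<open>b\<close> in the theorem, has nothing to do with growth: a nonconstant
  solution has a nonzero first derivative, whereas the bound for \<open>m = 1\<close> is not positive.
\<close>

lemma derivative_bound_violated:
  fixes s \<kappa> C\<^sub>0 M q \<epsilon> C :: real
  assumes "s > 0" "0 \<le> \<kappa>" "\<kappa> < 1" "C\<^sub>0 > 0" "M > 1" "\<epsilon> \<ge> 0" "C > 0"
    and gap: "q < (M - 1) * ((1 - \<kappa>) / s) powr (1 - \<kappa>) \<or> \<epsilon> > 0"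
  shows "\<exists>V \<in> potential_class \<kappa> C\<^sub>0 M. \<exists>u. normalized_solution s V u \<and>
    (\<exists>m. \<not> deriv_Linf_norm m u \<le>
      ereal (C * q ^ m * (fact m / ln (real m + exp 1) powr ((1 - \<kappa> + \<epsilon>) * real m))))"
proof (cases "q > 0")
  case True
  let ?S = "\<Sum>j. C\<^sub>0 ^ j / (fact j) powr s"
  define t where "t k = s / (1 - \<kappa>) * ln (real k)" for k :: nat
  define L where "L k = \<lfloor>M * t k powr \<kappa>\<rfloor>" for k
  define m where "m k = nat \<lceil>real k * t k\<rceil>" for k
  have "?S * C > 0" using assms sum_power_over_fact_powr_pos by simp
  from eventually_mode_beats_bound[OF assms(1-5) True assms(6) this gap]
  obtain k where k: "t k \<ge> 1" "real_of_int (L k) > 0"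
    "?S * C * (q ^ m k * (fact (m k) / ln (real (m k) + exp 1) powr ((1 - \<kappa> + \<epsilon>) * real (m k))))
      < (real k * L k) ^ m k * ((C\<^sub>0 * exp (- \<kappa> * t k) / L k powr s) ^ k / (fact k) powr s)"
    unfolding t_def L_def m_def by (auto simp: eventually_sequentially)
  have "real_of_int (L k) \<le> M * t k powr \<kappa>" by (simp add: L_def)
  moreover have "M > 0" "t k > 0" "L k > 0" using k assms by auto
  ultimately obtain V u where u: "V \<in> potential_class \<kappa> C\<^sub>0 M" "normalized_solution s V u"
    and *: "\<And>j m B. deriv_Linf_norm m u \<le> ereal B \<Longrightarrow>
      (real j * real_of_int (L k)) ^ m *
        ((C\<^sub>0 * exp (- \<kappa> * t k) / real_of_int (L k) powr s) ^ j / (fact j) powr s) \<le> ?S * B"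
    using exists_solution_with_large_derivatives[OF assms(1,2,4), of M "t k" "L k"] by blast
  have "\<not> deriv_Linf_norm (m k) u \<le> ereal (C * q ^ m k *
      (fact (m k) / ln (real (m k) + exp 1) powr ((1 - \<kappa> + \<epsilon>) * real (m k))))"
  proof
    let ?X = "fact (m k) / ln (real (m k) + exp 1) powr ((1 - \<kappa> + \<epsilon>) * real (m k))"
    assume "deriv_Linf_norm (m k) u \<le> ereal (C * q ^ m k * ?X)"
    from *[OF this, of k] have "\<not> ?S * (C * q ^ m k * ?X)
      < (real k * L k) ^ m k * ((C\<^sub>0 * exp (- \<kappa> * t k) / L k powr s) ^ k / (fact k) powr s)"
      by (rule leD)
    moreover have "?S * (C * q ^ m k * ?X) = ?S * C * (q ^ m k * ?X)"
      by (simp only: mult.assoc)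
    ultimately show False using k(3) by (simp only: not_True_eq_False)
  qed
  with u show ?thesis by blast
next
  case False
  have "\<lfloor>M\<rfloor> > 0" "M > 0" "real_of_int \<lfloor>M\<rfloor> \<le> M * 1 powr \<kappa>" using \<open>M > 1\<close> by auto
  then obtain V u where u: "V \<in> potential_class \<kappa> C\<^sub>0 M" "normalized_solution s V u"
    and *: "\<And>k m B. deriv_Linf_norm m u \<le> ereal B \<Longrightarrow>
      (real k * \<lfloor>M\<rfloor>) ^ m * ((C\<^sub>0 * exp (- \<kappa> * 1) / \<lfloor>M\<rfloor> powr s) ^ k / (fact k) powr s)
        \<le> (\<Sum>j. C\<^sub>0 ^ j / (fact j) powr s) * B"
    using exists_solution_with_large_derivatives[OF assms(1,2,4), of M 1 "\<lfloor>M\<rfloor>"] zero_less_one by blast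
  have "\<not> deriv_Linf_norm 1 u \<le> ereal (C * q ^ 1 *
      (fact 1 / ln (real 1 + exp 1) powr ((1 - \<kappa> + \<epsilon>) * real 1)))"
  proof
    let ?B = "C * q ^ 1 * (fact 1 / ln (real 1 + exp 1) powr ((1 - \<kappa> + \<epsilon>) * real 1))"
    assume "deriv_Linf_norm 1 u \<le> ereal ?B"
    from *[OF this, of 1] have "\<lfloor>M\<rfloor> * (C\<^sub>0 * exp (- \<kappa>) / \<lfloor>M\<rfloor> powr s) \<le> (\<Sum>j. C\<^sub>0 ^ j / (fact j) powr s) * ?B"
      by simp
    also have "(\<Sum>j. C\<^sub>0 ^ j / (fact j) powr s) * ?B \<le> 0"
    proof (rule mult_nonneg_nonpos)
      have "C * q ^ 1 \<le> 0"
        using False \<open>C > 0\<close> by (simp add: mult_nonneg_nonpos)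
      then show "?B \<le> 0"
        by (rule mult_nonpos_nonneg) simp
    qed (use sum_power_over_fact_powr_pos[OF assms(1,4)] in simp)
    also have "0 < \<lfloor>M\<rfloor> * (C\<^sub>0 * exp (- \<kappa>) / \<lfloor>M\<rfloor> powr s)"
      using \<open>\<lfloor>M\<rfloor> > 0\<close> \<open>C\<^sub>0 > 0\<close>
      by (intro mult_pos_pos divide_pos_pos) (simp_all del: zero_less_floor)
    finally show False by simp
  qed
  with u show ?thesis by blast
qed

theorem proposition4p1:
  fixes s \<kappa> C\<^sub>0 :: real
  assumes "s > 0" and "0 \<le> \<kappa>" and "\<kappa> < 1" and "C\<^sub>0 > 0"
  shows "(\<forall>b::real. b < ((1 - \<kappa>) / s) powr (1 - \<kappa>) \<longrightarrow>
            \<not> (\<exists>C>0. \<exists>K>0. \<forall>M>0. \<forall>V \<in> potential_class \<kappa> C\<^sub>0 M. \<forall>u. normalized_solution s V u \<longrightarrow>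
                 (\<forall>m. deriv_Linf_norm m u \<le>
                    ereal (C * (b * M + K) ^ m *
                      (fact m / (ln (real m + exp 1)) powr ((1 - \<kappa>) * real m))))))
       \<and> (\<forall>\<epsilon>>0. \<forall>\<theta>>1.
            \<not> (\<exists>C>0. \<exists>K>0. \<forall>M>0. \<forall>V \<in> potential_class \<kappa> C\<^sub>0 M. \<forall>u. normalized_solution s V u \<longrightarrow>
                 (\<forall>m. deriv_Linf_norm m u \<le>
                    ereal (C * (\<theta> * M * ((1 - \<kappa>) / s) powr (1 - \<kappa>) + K * (1 + C\<^sub>0 powr (1 / s)) ^ 2) ^ m *
                      (fact m / (ln (real m + exp 1)) powr ((1 - \<kappa> + \<epsilon>) * real m))))))"
proof (intro conjI allI impI)
  let ?\<beta> = "((1 - \<kappa>) / s) powr (1 - \<kappa>)"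
  fix b :: real assume b: "b < ?\<beta>"
  show "\<not> (\<exists>C>0. \<exists>K>0. \<forall>M>0. \<forall>V \<in> potential_class \<kappa> C\<^sub>0 M. \<forall>u. normalized_solution s V u \<longrightarrow>
      (\<forall>m. deriv_Linf_norm m u \<le> ereal (C * (b * M + K) ^ m *
        (fact m / (ln (real m + exp 1)) powr ((1 - \<kappa>) * real m)))))"
  proof (intro notI, elim exE conjE)
    fix C K :: real assume "C > 0" "K > 0"
    assume bound: "\<forall>M>0. \<forall>V \<in> potential_class \<kappa> C\<^sub>0 M. \<forall>u. normalized_solution s V u \<longrightarrow>
      (\<forall>m. deriv_Linf_norm m u \<le> ereal (C * (b * M + K) ^ m *
        (fact m / (ln (real m + exp 1)) powr ((1 - \<kappa>) * real m))))"
    \<comment> \<open>The choice needed is \<open>M (\<beta> - b) > K + \<beta>\<close> and \<open>M > 1\<close>, possible because \<open>b < \<beta>\<close>.\<close>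
    define M where "M = 2 + (K + ?\<beta>) / (?\<beta> - b)"
    have "M > 1" using b \<open>K > 0\<close> unfolding M_def by (smt (verit) divide_nonneg_pos powr_ge_zero)
    have "(M - 2) * (?\<beta> - b) = K + ?\<beta>" using b by (simp add: M_def)
    then have "b * M + K < (M - 1) * ?\<beta>" using b by (simp add: algebra_simps)
    then obtain V u m where "V \<in> potential_class \<kappa> C\<^sub>0 M" "normalized_solution s V u"
      "\<not> deriv_Linf_norm m u \<le> ereal (C * (b * M + K) ^ m *
          (fact m / ln (real m + exp 1) powr ((1 - \<kappa>) * real m)))"
      using derivative_bound_violated[OF assms(1-4) \<open>M > 1\<close> _ \<open>C > 0\<close>, of 0 "b * M + K"] by auto
    with bound[rule_format, of M V u m] \<open>M > 1\<close> show False by simp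
  qed
next
  fix \<epsilon> \<theta> :: real assume "\<epsilon> > 0" "\<theta> > 1"
  show "\<not> (\<exists>C>0. \<exists>K>0. \<forall>M>0. \<forall>V \<in> potential_class \<kappa> C\<^sub>0 M. \<forall>u. normalized_solution s V u \<longrightarrow>
      (\<forall>m. deriv_Linf_norm m u \<le>
        ereal (C * (\<theta> * M * ((1 - \<kappa>) / s) powr (1 - \<kappa>) + K * (1 + C\<^sub>0 powr (1 / s)) ^ 2) ^ m *
          (fact m / (ln (real m + exp 1)) powr ((1 - \<kappa> + \<epsilon>) * real m)))))"
  proof (intro notI, elim exE conjE)
    fix C K :: real assume "C > 0" "K > 0"
    assume bound: "\<forall>M>0. \<forall>V \<in> potential_class \<kappa> C\<^sub>0 M. \<forall>u. normalized_solution s V u \<longrightarrow>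
      (\<forall>m. deriv_Linf_norm m u \<le>
        ereal (C * (\<theta> * M * ((1 - \<kappa>) / s) powr (1 - \<kappa>) + K * (1 + C\<^sub>0 powr (1 / s)) ^ 2) ^ m *
          (fact m / (ln (real m + exp 1)) powr ((1 - \<kappa> + \<epsilon>) * real m))))"
    let ?q = "\<theta> * 2 * ((1 - \<kappa>) / s) powr (1 - \<kappa>) + K * (1 + C\<^sub>0 powr (1 / s)) ^ 2"
    obtain V u m where "V \<in> potential_class \<kappa> C\<^sub>0 2" "normalized_solution s V u"
      "\<not> deriv_Linf_norm m u \<le> ereal (C * ?q ^ m *
          (fact m / ln (real m + exp 1) powr ((1 - \<kappa> + \<epsilon>) * real m)))"
      using derivative_bound_violated[OF assms(1-4), of 2 \<epsilon> C ?q] \<open>\<epsilon> > 0\<close> \<open>C > 0\<close> by auto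
    with bound[rule_format, of 2 V u m] show False by simp
  qed
qed

end
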